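(* Let $\sigma$ be a root of $\mathcal P(\sigma;\delta,\nu)=0$. (i) If $\mathcal P'(\sigma;\delta,\nu)<0$, the solution $(\rho_*,\psi_* )$ of (MS) with asymptotics of type (E1) is unstable. (ii) If $\mathcal P'(\sigma;\delta,\nu)=0$ and $\mathcal P''(\sigma;\delta,\nu)<0$, the solution $(\rho_*,\psi_* )$ of (MS) with asymptotics of type (E2) with $\psi_1=\phi$ (i.e. $\psi_*(\tau)=\sigma+\phi\tau^{-1/4}+O(\tau^{-1/2})$) is unstable. (iii) If $\mathcal P'(\sigma;\delta,\nu)=\mathcal P''(\sigma;\delta,\nu)=0$ and $\mathcal P'''(\sigma;\delta,\nu)<0$, the solution $(\rho_*,\psi_* )$ of (MS) with asymptotics of type (E3) is unstable.
   Context: Let $\lambda>0$, $\nu\in[0,\pi)$, and let $\mu:[0,\infty)\to\mathbb R$ be a smooth function with asymptotic expansion $\mu(\tau)=\tau^{-1/2}\big(\mu_0+\sum_{k\ge1}\mu_k\tau^{-k}\big)$ as $\tau\to\infty$, with constants $\mu_k$. System (MS) for unknown functions $\rho(\tau),\psi(\tau)$, $\tau\ge0$, is $\frac{d\rho}{d\tau}+\mu(\tau)\rho\sin(2\psi+\nu)=\sin\psi$, $\quad\rho\big[\frac{d\psi}{d\tau}-\rho^2+\lambda\tau\big]+\mu(\tau)\rho\cos(2\psi+\nu)=\cos\psi$. Set $\delta:=\mu_0\sqrt\lambda$ and $\mathcal P(\sigma;\delta,\nu):=\delta\sin(2\sigma+\nu)-\sin\sigma$; primes on $\mathcal P$ denote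 derivatives in $\sigma$. Asymptotic expansion types (asymptotic series with constant coefficients as $\tau\to\infty$, $\sigma$ a root of $\mathcal P(\cdot;\delta,\nu)=0$): (E1) $\rho(\tau)\sim\sqrt\lambda\,\tau^{1/2}+\sum_{k\ge1}\rho_k\tau^{-k/2}$, $\psi(\tau)\sim\sigma+\sum_{k\ge1}\psi_k\tau^{-k/2}$ (here $\mathcal P'(\sigma;\delta,\nu)\ne0$, $\rho_1=0$, $\psi_1=-\sqrt\lambda/(2\mathcal P'(\sigma;\delta,\nu))$); (E2) $\rho(\tau)\sim\sqrt\lambda\,\tau^{1/2}+\sum_{k\ge2}\rho_k\tau^{-k/4}$, $\psi(\tau)\sim\sigma+\sum_{k\ge1}\psi_k\tau^{-k/4}$ with $\psi_1\in\{\phi,-\phi\}$, where $\phi:=\sqrt{-\sqrt\lambda/\mathcal P''(\sigma;\delta,\nu)}$ (requires $\mathcal P''(\sigma;\delta,\nu)<0$); (E3) $\rho(\tau)\sim\sqrt\lambda\,\tau^{1/2}+\sum_{k\ge2}\rho_k\tau^{-k/6}$, $\psi(\tau)\sim\sigma+\sum_{k\ge1}\psi_k\tau^{-k/6}$ with $\psi_1=-\chi$, $\chi:=\big(3\sqrt\lambda/\mathcal P'''(\sigma;\delta,\nu)\big)^{1/3}$. Stability is in the sense of Lyapunov: a solution $(\rho_*,\psi_* )$ of (MS) defined on $[0,\infty)$ is stable if for every $\varepsilon>0$ there is $\eta>0$ such that every solution with $|\rho(0)-\rho_*(0)|+|\psi(0)-\psi_*(0)|<\eta$ exists for all $\tau\ge0$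 and satisfies $|\rho(\tau)-\rho_*(\tau)|+|\psi(\tau)-\psi_*(\tau)|<\varepsilon$ for all $\tau\ge0$; it is unstable otherwise. *)

theory Defs
  imports "HOL-Analysis.Analysis" "HOL-Library.Landau_Symbols"
begin

definition PP :: "real \<Rightarrow> real \<Rightarrow> real \<Rightarrow> real" where
  "PP s d n = d * sin (2 * s + n) - sin s"
definition PP1 :: "real \<Rightarrow> real \<Rightarrow> real \<Rightarrow> real" where
  "PP1 s d n = 2 * d * cos (2 * s + n) - cos s"
definition PP2 :: "real \<Rightarrow> real \<Rightarrow> real \<Rightarrow> real" where
  "PP2 s d n = - 4 * d * sin (2 * s + n) + sin s"
definition PP3 :: "real \<Rightarrow> real \<Rightarrow> real \<Rightarrow> real" where
  "PP3 s d n = - 8 * d * cos (2 * s + n) + cos s"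

definition smooth_on_nonneg :: "(real \<Rightarrow> real) \<Rightarrow> bool" where
  "smooth_on_nonneg f \<longleftrightarrow> (\<exists>D :: nat \<Rightarrow> real \<Rightarrow> real. D 0 = f \<and>
     (\<forall>n. \<forall>t\<ge>0. (D n has_real_derivative D (Suc n) t) (at t within {0..})))"

definition mu_expansion :: "(real \<Rightarrow> real) \<Rightarrow> (nat \<Rightarrow> real) \<Rightarrow> bool" where
  "mu_expansion mu mc \<longleftrightarrow> (\<forall>N::nat.
     (\<lambda>t. mu t - t powr (-1/2) * (\<Sum>k=0..N. mc k * t powr (- real k)))
       \<in> O[at_top](\<lambda>t. t powr (-1/2 - real (N + 1))))"

definition asymp_series :: "(real \<Rightarrow> real) \<Rightarrow> (real \<Rightarrow> real) \<Rightarrow> nat \<Rightarrow> (nat \<Rightarrow> real) \<Rightarrow> bool" where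
  "asymp_series f g m a \<longleftrightarrow> (\<forall>N::nat.
     (\<lambda>t. f t - g t - (\<Sum>k=1..N. a k * t powr (- real k / real m)))
       \<in> O[at_top](\<lambda>t. t powr (- real (N + 1) / real m)))"

definition solves_MS ::
  "real \<Rightarrow> real \<Rightarrow> (real \<Rightarrow> real) \<Rightarrow> real set \<Rightarrow> (real \<Rightarrow> real) \<Rightarrow> (real \<Rightarrow> real) \<Rightarrow> bool" where
  "solves_MS lam nu mu S rho psi \<longleftrightarrow> (\<exists>drho dpsi. \<forall>t\<in>S.
     (rho has_real_derivative drho t) (at t within S) \<and>
     (psi has_real_derivative dpsi t) (at t within S) \<and>
     drho t + mu t * rho t * sin (2 * psi t + nu) = sin (psi t) \<and>
     rho t * (dpsi t - (rho t)\<^sup>2 + lam * t) + mu t * rho t * cos (2 * psi t + nu) = cos (psi t))"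

definition MS_stable ::
  "real \<Rightarrow> real \<Rightarrow> (real \<Rightarrow> real) \<Rightarrow> (real \<Rightarrow> real) \<Rightarrow> (real \<Rightarrow> real) \<Rightarrow> bool" where
  "MS_stable lam nu mu rs ps \<longleftrightarrow> (\<forall>eps>0. \<exists>eta>0. \<forall>r0 p0.
     \<bar>r0 - rs 0\<bar> + \<bar>p0 - ps 0\<bar> < eta \<longrightarrow>
       (\<exists>rho psi. solves_MS lam nu mu {0..} rho psi \<and> rho 0 = r0 \<and> psi 0 = p0) \<and>
       (\<forall>S rho psi. (S = {0..} \<or> (\<exists>T>0. S = {0..<T})) \<longrightarrow>
          solves_MS lam nu mu S rho psi \<longrightarrow> rho 0 = r0 \<longrightarrow> psi 0 = p0 \<longrightarrow>
          (\<forall>t\<in>S. \<bar>rho t - rs t\<bar> + \<bar>psi t - ps t\<bar> < eps)))"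

end

theory Submission
  imports Defs "HOL-Real_Asymp.Real_Asymp"
begin

text \<open>
  In the coordinate $z = \rho e^{i\psi}$ the system is the polynomial equation
  $z' = i (1 + z(|z|^2 - \lambda\tau) - \mu e^{-i\nu} \bar z)$, so its solutions depend injectively and
  continuously on the initial values, and by invariance of domain the values at time $T$ of the
  solutions starting near $(\rho_*,\psi_*)$ fill a neighbourhood of $z_*(T)$. If the solution were
  stable, some solution confined to its $\varepsilon$-tube would thus satisfy
  $R = \rho-\rho_* > 0$ and $\Psi = \psi-\psi_* > 0$ at time $T$. In this quadrant
  $R' \approx -\mathcal P'(\xi)\Psi$ with $\xi \ge \psi_*$, and $\Psi' \approx 2\sqrt\lambda\,\tau^{1/2}R$. In all
  three cases $-\mathcal P'(\xi) \ge a\tau^{-1/3}$ for $\xi\in[\psi_*,\psi_*+\varepsilon]$, whence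
  $(R\Psi)' \ge R\Psi$ for large $\tau$ and $R\Psi$ grows exponentially, which contradicts confinement.
  Only perturbations with $\Psi > 0$ are used: in the degenerate cases $\mathcal P'$ may vanish or change sign
  in the tube below $\psi_*$.
\<close>

section \<open>Gronwall estimates and the system in complex form\<close>

text \<open>By Cauchy-Schwarz the derivative 2 (w, w') of |w|^2 lies between -2L |w|^2 and 2L |w|^2.
  Hence exp(-2Lt) |w|^2 decreases, which is the forward bound, and exp(2Lt) |w|^2 increases, which
  is the backward bound.\<close>

lemma gronwall_inner:
  fixes w w' :: "real \<Rightarrow> 'a::real_inner"
  assumes T: "0 \<le> T"
    and der: "\<And>t. t \<in> {0..T} \<Longrightarrow> (w has_vector_derivative w' t) (at t within {0..T})"
    and bound: "\<And>t. t \<in> {0..T} \<Longrightarrow> norm (w' t) \<le> L * norm (w t)"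
  shows "(norm (w T))\<^sup>2 \<le> exp (2 * L * T) * (norm (w 0))\<^sup>2"
    and "(norm (w 0))\<^sup>2 \<le> exp (2 * L * T) * (norm (w T))\<^sup>2"
proof -
  have cont: "continuous_on {0..T} w"
    using der has_vector_derivative_continuous continuous_on_eq_continuous_within by blast
  have D: "((\<lambda>t. exp (c * t) * (norm (w t))\<^sup>2) has_real_derivative
      exp (c * t) * (c * (norm (w t))\<^sup>2 + 2 * (w t \<bullet> w' t))) (at t)"
    if "0 < t" "t < T" for t c
  proof -
    have w: "(w has_vector_derivative w' t) (at t)"
      using der[of t] that by (simp add: at_within_Icc_at)
    have "((\<lambda>t. w t \<bullet> w t) has_derivative (\<lambda>h. w t \<bullet> (h *\<^sub>R w' t) + (h *\<^sub>R w' t) \<bullet> w t)) (at t)"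
      using w unfolding has_vector_derivative_def by (intro has_derivative_inner)
    then have N: "((\<lambda>t. w t \<bullet> w t) has_real_derivative 2 * (w t \<bullet> w' t)) (at t)"
      unfolding has_field_derivative_def
      by (rule has_derivative_eq_rhs) (auto simp: inner_commute fun_eq_iff)
    show ?thesis
      unfolding power2_norm_eq_inner
      by (auto intro!: derivative_eq_intros N simp: algebra_simps)
  qed
  have ip: "\<bar>w t \<bullet> w' t\<bar> \<le> L * (norm (w t))\<^sup>2" if "t \<in> {0..T}" for t
  proof -
    have "\<bar>w t \<bullet> w' t\<bar> \<le> norm (w t) * norm (w' t)"
      by (rule Cauchy_Schwarz_ineq2)
    also have "\<dots> \<le> norm (w t) * (L * norm (w t))"
      using bound[OF that] by (intro mult_left_mono) auto
    finally show ?thesis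
      by (simp add: power2_eq_square algebra_simps)
  qed
  have "exp (2 * L * 0) * (norm (w 0))\<^sup>2 \<le> exp (2 * L * T) * (norm (w T))\<^sup>2"
  proof (rule DERIV_nonneg_imp_increasing_open[OF T])
    fix t assume t: "0 < t" "t < T"
    have "0 \<le> exp (2 * L * t) * (2 * L * (norm (w t))\<^sup>2 + 2 * (w t \<bullet> w' t))"
      using ip[of t] t by simp
    then show "\<exists>y. ((\<lambda>t. exp (2 * L * t) * (norm (w t))\<^sup>2) has_real_derivative y) (at t) \<and> 0 \<le> y"
      using D[OF t, of "2 * L"] by blast
  qed (intro continuous_intros cont)
  then show "(norm (w 0))\<^sup>2 \<le> exp (2 * L * T) * (norm (w T))\<^sup>2"
    by simp
  have "exp (- (2 * L) * T) * (norm (w T))\<^sup>2 \<le> exp (- (2 * L) * 0) * (norm (w 0))\<^sup>2"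
  proof (rule DERIV_nonpos_imp_decreasing_open[OF T])
    fix t assume t: "0 < t" "t < T"
    have "exp (- (2 * L) * t) * (- (2 * L) * (norm (w t))\<^sup>2 + 2 * (w t \<bullet> w' t)) \<le> 0"
      using ip[of t] t by (simp add: mult_le_0_iff)
    then show "\<exists>y. ((\<lambda>t. exp (- (2 * L) * t) * (norm (w t))\<^sup>2) has_real_derivative y) (at t) \<and> y \<le> 0"
      using D[OF t, of "- (2 * L)"] by blast
  qed (intro continuous_intros cont)
  then show "(norm (w T))\<^sup>2 \<le> exp (2 * L * T) * (norm (w 0))\<^sup>2"
    by (simp add: exp_minus field_simps)
qed

text \<open>Polynomial in the real and imaginary parts of z, hence locally Lipschitz also across z =
  0, where the polar equations degenerate.\<close>

definition MS_field :: "real \<Rightarrow> real \<Rightarrow> (real \<Rightarrow> real) \<Rightarrow> real \<Rightarrow> complex \<Rightarrow> complex" where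
  "MS_field lam nu mu t z =
     \<i> * (1 + of_real ((cmod z)\<^sup>2 - lam * t) * z - of_real (mu t) * cis (- nu) * cnj z)"

text \<open>The velocity of the complex coordinate is e^(i psi) (rho' + i rho psi'). The second
  equation determines exactly the product rho psi', so nothing is divided by \<open>rho\<close>, and
  times with \<open>rho t\<close> zero or negative are covered as well.\<close>

lemma solves_MS_rcis:
  assumes "solves_MS lam nu mu S rho psi" "t \<in> S"
  shows "((\<lambda>t. rcis (rho t) (psi t)) has_vector_derivative
           MS_field lam nu mu t (rcis (rho t) (psi t))) (at t within S)"
proof -
  obtain dr dp where
    r: "(rho has_real_derivative dr) (at t within S)" and
    p: "(psi has_real_derivative dp) (at t within S)" and
    e1: "dr + mu t * rho t * sin (2 * psi t + nu) = sin (psi t)" and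
    e2: "rho t * (dp - (rho t)\<^sup>2 + lam * t) + mu t * rho t * cos (2 * psi t + nu) = cos (psi t)"
    using assms unfolding solves_MS_def by blast
  define s c where "s = sin (2 * psi t + nu)" and "c = cos (2 * psi t + nu)"
  have dr: "dr = sin (psi t) - mu t * rho t * s"
    using e1 by (simp add: s_def)
  have dp: "rho t * dp = cos (psi t) + rho t * ((rho t)\<^sup>2 - lam * t) - mu t * rho t * c"
    using e2 by (simp add: c_def algebra_simps)
  \<comment> \<open>The conjugate in the field produces the angle \<open>psi t + nu\<close>, whereas
    (MS) contains \<open>2 * psi t + nu\<close>; the addition formulas translate between the
    two.\<close>
  have "psi t + nu = (2 * psi t + nu) - psi t"
    by simp
  then have add: "sin (psi t + nu) = s * cos (psi t) - c * sin (psi t)"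
      "cos (psi t + nu) = c * cos (psi t) + s * sin (psi t)"
    unfolding s_def c_def by (metis sin_diff, metis cos_diff)
  have conj: "cis (- nu) * cnj (rcis (rho t) (psi t)) =
      Complex (rho t * cos (psi t + nu)) (- rho t * sin (psi t + nu))"
    by (simp add: complex_eq_iff cos_add sin_add algebra_simps)
  have Re: "Re (MS_field lam nu mu t (rcis (rho t) (psi t))) = dr * cos (psi t) - (rho t * dp) * sin (psi t)"
    unfolding MS_field_def mult.assoc conj dr dp add by (simp add: algebra_simps)
  have Im: "Im (MS_field lam nu mu t (rcis (rho t) (psi t))) = dr * sin (psi t) + (rho t * dp) * cos (psi t)"
  proof -
    \<comment> \<open>The constant forcing term of the field has imaginary part 1, which the polar
      side yields as a sum of squares.\<close>
    have "1 = (sin (psi t))\<^sup>2 + (cos (psi t))\<^sup>2"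
      by simp
    then show ?thesis
      unfolding MS_field_def mult.assoc conj dr dp add by (simp add: algebra_simps power2_eq_square)
  qed
  show ?thesis
    unfolding has_vector_derivative_complex_iff Re Im
    by (auto intro!: derivative_eq_intros r p simp: algebra_simps)
qed

text \<open>Only the cubic term is nonlinear. With w = z1 - z2 it splits as |z1|^2 w + (|z1|^2 -
  |z2|^2) z2; the two summands contribute M^2 and 2 M^2.\<close>

lemma MS_field_lipschitz:
  assumes "cmod z1 \<le> M" "cmod z2 \<le> M" "\<bar>lam * t\<bar> \<le> K" "\<bar>mu t\<bar> \<le> B"
  shows "cmod (MS_field lam nu mu t z1 - MS_field lam nu mu t z2) \<le> (3 * M\<^sup>2 + K + B) * cmod (z1 - z2)"
proof -
  define w where "w = z1 - z2"
  have M: "0 \<le> M"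
    using assms(1) norm_ge_zero order_trans by blast
  have "MS_field lam nu mu t z1 - MS_field lam nu mu t z2 =
     \<i> * (of_real ((cmod z1)\<^sup>2) * w + of_real ((cmod z1)\<^sup>2 - (cmod z2)\<^sup>2) * z2
       - of_real (lam * t) * w - of_real (mu t) * cis (- nu) * cnj w)"
    by (simp add: MS_field_def w_def algebra_simps)
  also have "cmod \<dots> = cmod (of_real ((cmod z1)\<^sup>2) * w + of_real ((cmod z1)\<^sup>2 - (cmod z2)\<^sup>2) * z2
       - of_real (lam * t) * w - of_real (mu t) * cis (- nu) * cnj w)"
    by (simp add: norm_mult)
  also have "\<dots> \<le> cmod (of_real ((cmod z1)\<^sup>2) * w) + cmod (of_real ((cmod z1)\<^sup>2 - (cmod z2)\<^sup>2) * z2)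
       + cmod (of_real (lam * t) * w) + cmod (of_real (mu t) * cis (- nu) * cnj w)"
    by (meson norm_triangle_ineq norm_triangle_ineq4 order_trans add_mono order_refl)
  also have "\<dots> = (cmod z1)\<^sup>2 * cmod w + \<bar>(cmod z1)\<^sup>2 - (cmod z2)\<^sup>2\<bar> * cmod z2
       + \<bar>lam * t\<bar> * cmod w + \<bar>mu t\<bar> * cmod w"
    unfolding norm_mult norm_of_real norm_cis complex_mod_cnj by simp
  also have "\<dots> \<le> M\<^sup>2 * cmod w + (2 * M * cmod w) * M + K * cmod w + B * cmod w"
  proof (intro add_mono mult_right_mono mult_mono power_mono assms norm_ge_zero)
    have "\<bar>(cmod z1)\<^sup>2 - (cmod z2)\<^sup>2\<bar> = (cmod z1 + cmod z2) * \<bar>cmod z1 - cmod z2\<bar>"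
      by (simp add: power2_eq_square square_diff_square_factored abs_mult)
    also have "\<dots> \<le> (2 * M) * cmod w"
      unfolding w_def using assms(1,2) M by (intro mult_mono norm_triangle_ineq3) auto
    finally show "\<bar>(cmod z1)\<^sup>2 - (cmod z2)\<^sup>2\<bar> \<le> 2 * M * cmod w" .
  qed (use M in auto)
  finally show ?thesis
    by (simp add: w_def algebra_simps power2_eq_square)
qed

section \<open>Openness of the map from initial values to values at time T\<close>

text \<open>Polar coordinates are ambiguous up to full turns of the angle and up to changing the
  sign of the radius with a half turn. The bound on the angles excludes the former, the sign
  condition the latter.\<close>

lemma rcis_eq_near_imp_eq:
  assumes "rcis r1 p1 = rcis r2 p2" "0 < r1 * r2" "\<bar>p1 - p2\<bar> < 2 * pi"
  shows "r1 = r2 \<and> p1 = p2"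
proof -
  have "\<bar>r1\<bar> = \<bar>r2\<bar>"
    using arg_cong[OF assms(1), of cmod] by simp
  then have r: "r1 = r2"
    using assms(2) by (auto simp: abs_if zero_less_mult_iff split: if_splits)
  then have "cis p1 = cis p2"
    using assms by (auto simp: rcis_def)
  then have "cis (p1 - p2) = 1"
    by (simp flip: cis_divide)
  then have "cos (p1 - p2) = 1"
    by (simp add: complex_eq_iff)
  then obtain n :: int where "p1 - p2 = of_int n * 2 * pi"
    by (auto simp: cos_one_2pi_int)
  then have "p1 - p2 = of_int n * (2 * pi)" "\<bar>real_of_int n\<bar> < 1"
    using assms(3) by (auto simp: abs_mult)
  moreover from this(2) have "n = 0"
    by linarith
  ultimately show ?thesis
    using r by simp
qed

text \<open>The forward estimate serves for continuity of the time-\<open>T\<close> map and for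
  uniqueness in the complex coordinate, the backward one for injectivity.\<close>

lemma MS_compare:
  assumes sol1: "solves_MS lam nu mu {0..} rho1 psi1"
    and sol2: "solves_MS lam nu mu {0..} rho2 psi2"
    and T: "0 \<le> T"
    and M: "\<And>t. t \<in> {0..T} \<Longrightarrow> \<bar>rho1 t\<bar> \<le> M" "\<And>t. t \<in> {0..T} \<Longrightarrow> \<bar>rho2 t\<bar> \<le> M"
    and B: "\<And>t. t \<in> {0..T} \<Longrightarrow> \<bar>mu t\<bar> \<le> B"
  defines "C \<equiv> exp ((3 * M\<^sup>2 + \<bar>lam\<bar> * T + B) * T)"
  shows "cmod (rcis (rho1 T) (psi1 T) - rcis (rho2 T) (psi2 T))
           \<le> C * cmod (rcis (rho1 0) (psi1 0) - rcis (rho2 0) (psi2 0))"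
    and "cmod (rcis (rho1 0) (psi1 0) - rcis (rho2 0) (psi2 0))
           \<le> C * cmod (rcis (rho1 T) (psi1 T) - rcis (rho2 T) (psi2 T))"
proof -
  define L where "L = 3 * M\<^sup>2 + \<bar>lam\<bar> * T + B"
  define w where "w t = rcis (rho1 t) (psi1 t) - rcis (rho2 t) (psi2 t)" for t
  define w' where "w' t = MS_field lam nu mu t (rcis (rho1 t) (psi1 t))
      - MS_field lam nu mu t (rcis (rho2 t) (psi2 t))" for t
  have der: "(w has_vector_derivative w' t) (at t within {0..T})" if "t \<in> {0..T}" for t
    unfolding w_def w'_def using that
    by (intro has_vector_derivative_diff has_vector_derivative_within_subset[OF solves_MS_rcis[OF sol1]]
          has_vector_derivative_within_subset[OF solves_MS_rcis[OF sol2]]) auto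
  have bound: "norm (w' t) \<le> L * norm (w t)" if "t \<in> {0..T}" for t
    unfolding w_def w'_def L_def using that M[OF that] B[OF that]
    by (intro MS_field_lipschitz) (auto simp: abs_mult intro!: mult_left_mono)
  have C2: "exp (2 * L * T) = C\<^sup>2"
    by (simp add: C_def L_def exp_double [symmetric] mult.assoc)
  have C0: "0 \<le> C"
    by (simp add: C_def)
  have g: "(norm (w T))\<^sup>2 \<le> (C * norm (w 0))\<^sup>2" "(norm (w 0))\<^sup>2 \<le> (C * norm (w T))\<^sup>2"
    unfolding power_mult_distrib C2[symmetric] by (rule gronwall_inner[OF T der bound]; assumption)+
  have "norm (w T) \<le> C * norm (w 0)" "norm (w 0) \<le> C * norm (w T)"
    by (rule power2_le_imp_le[OF g(1)] power2_le_imp_le[OF g(2)], simp add: C0)+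
  then show "cmod (rcis (rho1 T) (psi1 T) - rcis (rho2 T) (psi2 T))
           \<le> C * cmod (rcis (rho1 0) (psi1 0) - rcis (rho2 0) (psi2 0))"
    "cmod (rcis (rho1 0) (psi1 0) - rcis (rho2 0) (psi2 0))
           \<le> C * cmod (rcis (rho1 T) (psi1 T) - rcis (rho2 T) (psi2 T))"
    by (simp_all only: w_def)
qed

lemma solves_MS_continuous:
  assumes "solves_MS lam nu mu S rho psi"
  shows "continuous_on S rho" "continuous_on S psi"
  using assms unfolding solves_MS_def
  by (meson DERIV_continuous continuous_on_eq_continuous_within)+

text \<open>Invariance of domain, applied to the map from the pair of initial values to the complex
  value at time \<open>T\<close>. The solutions themselves are supplied by \<open>close\<close>, and
  \<open>f\<close> selects one for each pair.\<close>

lemma MS_reach_open: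
  assumes mu: "continuous_on {0..} mu"
    and star: "solves_MS lam nu mu {0..} rs ps"
    and rs0: "rs 0 \<noteq> 0" and T: "0 \<le> T" and eta: "0 < eta"
    and close: "\<And>r0 p0. \<bar>r0 - rs 0\<bar> + \<bar>p0 - ps 0\<bar> < eta \<Longrightarrow>
       \<exists>rho psi. solves_MS lam nu mu {0..} rho psi \<and> rho 0 = r0 \<and> psi 0 = p0 \<and>
         (\<forall>t\<ge>0. \<bar>rho t - rs t\<bar> + \<bar>psi t - ps t\<bar> < e)"
  shows "\<exists>d>0. \<forall>w\<in>ball (rcis (rs T) (ps T)) d.
       \<exists>rho psi. solves_MS lam nu mu {0..} rho psi \<and> rcis (rho T) (psi T) = w \<and>
         (\<forall>t\<ge>0. \<bar>rho t - rs t\<bar> + \<bar>psi t - ps t\<bar> < e)"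
proof -
  \<comment> \<open>The initial pair is stored in Cartesian form: the real part of a parameter is
    the initial \<open>rho\<close>, the imaginary part the initial \<open>psi\<close>.\<close>
  define c where "c = Complex (rs 0) (ps 0)"
  \<comment> \<open>The radius \<open>eta / 2\<close> makes the sum of both deviations less than
    \<open>eta\<close>; \<open>\<bar>rs 0\<bar>\<close> fixes the sign of the initial
    \<open>rho\<close>; 1 keeps any two initial angles less than 2, hence less than a full turn,
    apart.\<close>
  define U where "U = ball c (min (eta / 2) (min \<bar>rs 0\<bar> 1))"
  have U: "\<bar>Re a - rs 0\<bar> + \<bar>Im a - ps 0\<bar> < eta" "\<bar>Re a - rs 0\<bar> < \<bar>rs 0\<bar>" "\<bar>Im a - ps 0\<bar> < 1"
    if "a \<in> U" for a
    using that abs_Re_le_cmod[of "c - a"] abs_Im_le_cmod[of "c - a"]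
    by (auto simp: U_def c_def dist_norm)
  have cU: "c \<in> U"
    using eta rs0 by (simp add: U_def)
  have "\<exists>f. solves_MS lam nu mu {0..} (fst f) (snd f) \<and> fst f 0 = Re a \<and> snd f 0 = Im a \<and>
         (\<forall>t\<ge>0. \<bar>fst f t - rs t\<bar> + \<bar>snd f t - ps t\<bar> < e)" if "a \<in> U" for a
    using close[OF U(1)[OF that]] by force
  then obtain f where f: "\<And>a. a \<in> U \<Longrightarrow> solves_MS lam nu mu {0..} (fst (f a)) (snd (f a))"
      "\<And>a. a \<in> U \<Longrightarrow> fst (f a) 0 = Re a" "\<And>a. a \<in> U \<Longrightarrow> snd (f a) 0 = Im a"
      "\<And>a t. a \<in> U \<Longrightarrow> 0 \<le> t \<Longrightarrow> \<bar>fst (f a) t - rs t\<bar> + \<bar>snd (f a) t - ps t\<bar> < e"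
    by metis
  define F where "F a = rcis (fst (f a) T) (snd (f a) T)" for a
  define F0 where "F0 a = rcis (Re a) (Im a)" for a
  have "bounded (rs ` {0..T})" "bounded (mu ` {0..T})"
    using solves_MS_continuous(1)[OF star] mu
    by (auto intro!: compact_imp_bounded compact_continuous_image intro: continuous_on_subset)
  then obtain M0 B where M0: "\<And>t. t \<in> {0..T} \<Longrightarrow> \<bar>rs t\<bar> \<le> M0"
      and B: "\<And>t. t \<in> {0..T} \<Longrightarrow> \<bar>mu t\<bar> \<le> B"
    by (fastforce simp: bounded_iff)
  have e: "0 < e"
    using f(4)[OF cU, of 0] by linarith
  \<comment> \<open>Confinement to the \<open>e\<close>-tube bounds all selected solutions at once,
    so that a single Gronwall constant \<open>C\<close> serves every pair of parameters in
    \<open>U\<close>.\<close>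
  have M1: "\<bar>fst (f a) t\<bar> \<le> M0 + e" if "t \<in> {0..T}" "a \<in> U" for a t
    using f(4)[OF that(2), of t] M0[OF that(1)] that(1) by auto
  have M2: "\<bar>rs t\<bar> \<le> M0 + e" if "t \<in> {0..T}" for t
    using M0[OF that] e by auto
  define C where "C = exp ((3 * (M0 + e)\<^sup>2 + \<bar>lam\<bar> * T + B) * T)"
  have le: "cmod (F a - F b) \<le> C * cmod (F0 a - F0 b)" "cmod (F0 a - F0 b) \<le> C * cmod (F a - F b)"
    if "a \<in> U" "b \<in> U" for a b
    using MS_compare[OF f(1)[OF that(1)] f(1)[OF that(2)] T M1[OF _ that(1)] M1[OF _ that(2)] B] that
    by (simp_all add: F_def F0_def C_def f)
  have "continuous_on U F"
    unfolding continuous_on_def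
  proof
    fix a assume a: "a \<in> U"
    have "continuous_on UNIV F0"
      unfolding F0_def by (intro continuous_intros)
    then have "((\<lambda>b. F0 b) \<longlongrightarrow> F0 a) (at a within U)"
      by (meson UNIV_I continuous_on_def continuous_on_subset a subset_UNIV)
    then have "((\<lambda>b. C * cmod (F0 b - F0 a)) \<longlongrightarrow> C * cmod (F0 a - F0 a)) (at a within U)"
      by (intro tendsto_intros)
    then have "((\<lambda>b. C * cmod (F0 b - F0 a)) \<longlongrightarrow> 0) (at a within U)"
      by simp
    moreover have "\<forall>\<^sub>F b in at a within U. cmod (F b - F a) \<le> C * cmod (F0 b - F0 a)"
      unfolding eventually_at_filter by (intro always_eventually allI impI le(1) a)
    ultimately have "((\<lambda>b. F b - F a) \<longlongrightarrow> 0) (at a within U)"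
      by (rule Lim_null_comparison[rotated])
    then show "(F \<longlongrightarrow> F a) (at a within U)"
      by (rule LIM_zero_cancel)
  qed
  moreover have "inj_on F U"
  proof (rule inj_onI)
    fix a b assume ab: "a \<in> U" "b \<in> U" "F a = F b"
    then have "F0 a = F0 b"
      using le(2)[of a b] by simp
    moreover have "0 < Re a * Re b"
      using U(2)[OF ab(1)] U(2)[OF ab(2)] by (auto simp: zero_less_mult_iff abs_if split: if_splits)
    moreover have "\<bar>Im a - Im b\<bar> < 2 * pi"
      using U(3)[OF ab(1)] U(3)[OF ab(2)] pi_gt3 by linarith
    ultimately have "Re a = Re b \<and> Im a = Im b"
      unfolding F0_def by (rule rcis_eq_near_imp_eq)
    then show "a = b"
      by (simp add: complex_eq_iff)
  qed
  ultimately have "open (F ` U)"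
    by (intro invariance_of_domain) (auto simp: U_def)
  \<comment> \<open>The selected solution \<open>f c\<close> and the reference solution share their
    initial values, so the forward estimate has right-hand side 0.\<close>
  moreover have "F c = rcis (rs T) (ps T)"
    using MS_compare(1)[OF f(1)[OF cU] star T M1[OF _ cU] M2 B] f(2,3)[OF cU]
    by (simp add: F_def c_def)
  then have "rcis (rs T) (ps T) \<in> F ` U"
    using cU by (metis imageI)
  ultimately obtain d where d: "d > 0" "ball (rcis (rs T) (ps T)) d \<subseteq> F ` U"
    by (meson open_contains_ball)
  show ?thesis
  proof (intro exI[of _ d] conjI ballI d(1))
    fix w assume "w \<in> ball (rcis (rs T) (ps T)) d"
    then obtain a where "a \<in> U" "w = F a"
      using d by blast
    then show "\<exists>rho psi. solves_MS lam nu mu {0..} rho psi \<and> rcis (rho T) (psi T) = w \<and>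
         (\<forall>t\<ge>0. \<bar>rho t - rs t\<bar> + \<bar>psi t - ps t\<bar> < e)"
      using f(1,4)[OF \<open>a \<in> U\<close>] unfolding F_def by blast
  qed
qed

section \<open>Exponential growth in the open positive quadrant\<close>

text \<open>As long as both functions are positive, exp(-(t - T)) R P is nondecreasing. At a first
  exit from the quadrant this product would be 0, although it is at least its positive initial
  value. So the quadrant is never left, and the growth continues for all time.\<close>

lemma quadrant_escape:
  fixes R P R' P' :: "real \<Rightarrow> real"
  assumes R: "\<And>t. t \<ge> T \<Longrightarrow> (R has_real_derivative R' t) (at t within {T..})"
    and P: "\<And>t. t \<ge> T \<Longrightarrow> (P has_real_derivative P' t) (at t within {T..})"
    and init: "0 < R T" "0 < P T"
    and grow: "\<And>t. \<lbrakk>t \<ge> T; 0 < R t; 0 < P t\<rbrakk> \<Longrightarrow> R t * P t \<le> R' t * P t + R t * P' t"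
  shows "\<exists>t\<ge>T. K < R t * P t"
proof -
  have contR: "continuous_on {T..} R" and contP: "continuous_on {T..} P"
    using R P by (meson DERIV_continuous continuous_on_eq_continuous_within atLeast_iff)+
  have mono: "R T * P T \<le> exp (- (s - T)) * (R s * P s)"
    if s: "T \<le> s" and pos: "\<And>t. T \<le> t \<Longrightarrow> t < s \<Longrightarrow> 0 < R t \<and> 0 < P t" for s
  proof -
    have "exp (- (T - T)) * (R T * P T) \<le> exp (- (s - T)) * (R s * P s)"
    proof (rule DERIV_nonneg_imp_increasing_open[OF s])
      fix t assume t: "T < t" "t < s"
      then have at: "at t within {T..} = at t"
        by (intro at_within_interior) simp
      have D: "((\<lambda>t. exp (- (t - T)) * (R t * P t)) has_real_derivative
          exp (- (t - T)) * (R' t * P t + R t * P' t - R t * P t)) (at t)"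
        using R[of t] P[of t] t unfolding at
        by (auto intro!: derivative_eq_intros simp: algebra_simps)
      have "0 \<le> exp (- (t - T)) * (R' t * P t + R t * P' t - R t * P t)"
        using grow[of t] pos[of t] t by simp
      with D show "\<exists>y. ((\<lambda>t. exp (- (t - T)) * (R t * P t)) has_real_derivative y) (at t) \<and> 0 \<le> y"
        by blast
    qed (intro continuous_intros continuous_on_subset[OF contR] continuous_on_subset[OF contP], auto)
    then show ?thesis
      by simp
  qed
  have pos: "0 < R t \<and> 0 < P t" if "T \<le> t" for t
  proof (rule ccontr)
    assume neg: "\<not> (0 < R t \<and> 0 < P t)"
    \<comment> \<open>\<open>A\<close> collects the times outside the open quadrant. Being closed,
      it contains its infimum, the first exit time.\<close>
    define A where "A = {T..} \<inter> (\<lambda>s. min (R s) (P s)) -` {..0}"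
    have "closed A"
      unfolding A_def by (intro continuous_closed_preimage continuous_intros contR contP)
    moreover have "t \<in> A"
      using neg that by (auto simp: A_def)
    moreover have bdd: "bdd_below A"
      by (auto simp: A_def intro: bdd_belowI[of _ T])
    ultimately have inf: "Inf A \<in> A"
      by (intro closed_contains_Inf) auto
    have below: "0 < R s \<and> 0 < P s" if "T \<le> s" "s < Inf A" for s
    proof -
      have "s \<notin> A"
        using that(2) bdd by (meson cInf_lower not_le)
      then show ?thesis
        using that(1) by (auto simp: A_def min_def split: if_splits)
    qed
    define s where "s = Inf A"
    have s: "T \<le> s" "min (R s) (P s) \<le> 0"
      using inf by (auto simp: A_def s_def)
    have "s \<noteq> T"
      using s init by (auto simp: min_def split: if_splits)
    then have lt: "T < s"
      using s by simp
    have lims: "(R \<longlongrightarrow> R s) (at s within {T..})" "(P \<longlongrightarrow> P s) (at s within {T..})"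
      using contR contP s by (auto simp: continuous_on_def)
    \<comment> \<open>As left limits of positive values, both functions are nonnegative at the exit
      time. One of them must then vanish there, which contradicts the positive lower bound from
      \<open>mono\<close>.\<close>
    have nn: "0 \<le> f s" if "(f \<longlongrightarrow> f s) (at s within {T..})" "\<And>x. T \<le> x \<Longrightarrow> x < s \<Longrightarrow> 0 < f x"
      for f :: "real \<Rightarrow> real"
    proof (rule tendsto_lowerbound)
      show "(f \<longlongrightarrow> f s) (at_left s)"
        using that(1) lt at_within_interior[of s "{T..}"]
        by (simp add: filterlim_at_split)
      show "\<forall>\<^sub>F x in at_left s. 0 \<le> f x"
        unfolding eventually_at_left_field using lt that(2)
        by (intro bexI[of _ T] exI[of _ T]) (auto intro: less_imp_le)
    qed simp
    have "0 \<le> R s" "0 \<le> P s"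
      using nn[OF lims(1)] nn[OF lims(2)] below by (auto simp: s_def)
    moreover have "0 < exp (- (s - T)) * (R s * P s)"
      using mono[of s] below s init by (auto simp: s_def intro: less_le_trans[OF mult_pos_pos])
    ultimately show False
      using s by (auto simp: zero_less_mult_iff min_def split: if_splits)
  qed
  \<comment> \<open>Chosen so that already the linear minorant 1 + (t - T) of the exponential lifts
    the initial product to \<open>R T * P T + \<bar>K\<bar>\<close>.\<close>
  define t where "t = T + \<bar>K\<bar> / (R T * P T)"
  have V0: "0 < R T * P T"
    using init by simp
  have t: "T \<le> t"
    using V0 by (simp add: t_def)
  have "(t - T) * (R T * P T) = \<bar>K\<bar>"
    using init by (simp add: t_def)
  then have "(1 + (t - T)) * (R T * P T) = R T * P T + \<bar>K\<bar>"
    by (simp only: distrib_right mult_1_left)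
  then have "K < (1 + (t - T)) * (R T * P T)"
    using V0 by linarith
  also have "\<dots> \<le> exp (t - T) * (R T * P T)"
    using V0 by (intro mult_right_mono exp_ge_add_one_self) auto
  also have "\<dots> \<le> exp (t - T) * (exp (- (t - T)) * (R t * P t))"
    using mono[OF t pos] by (intro mult_left_mono) auto
  also have "\<dots> = R t * P t"
    by (simp only: mult.assoc[symmetric] exp_add[symmetric]) simp
  finally show ?thesis
    using t by blast
qed

lemma cos_diff_le: "\<bar>cos a - cos b\<bar> \<le> \<bar>a - b\<bar>" for a b :: real
proof -
  have "\<bar>cos a - cos b\<bar> = 2 * (\<bar>sin ((a + b) / 2)\<bar> * \<bar>sin ((b - a) / 2)\<bar>)"
    by (simp add: cos_diff_cos abs_mult)
  also have "\<dots> \<le> 2 * (1 * \<bar>(b - a) / 2\<bar>)"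
    by (intro mult_left_mono mult_mono abs_sin_x_le_abs_x) auto
  finally show ?thesis
    by simp
qed

text \<open>A statement about numbers: all quantities are values at one instant, with
  \<open>L\<close> for lam t and \<open>m\<close> for mu. The two equations give R' >= P/r - |m| R
  and P' >= r R - (1/r + 2|m|) P. In R' P + R P' the squares sum to at least 2 R P, and by
  \<open>small\<close> the cross terms cost at most R P.\<close>

lemma MS_quadrant_growth:
  fixes r p dr dp R P dr' dp' m nu L :: real
  assumes r: "2 \<le> r" and small: "3 * \<bar>m\<bar> + 1 / r \<le> 1" and R: "0 < R" and P: "0 < P"
    and slope: "\<And>xi. \<lbrakk>p \<le> xi; xi \<le> p + P\<rbrakk> \<Longrightarrow> 1 \<le> r * (cos xi - 2 * m * r * cos (2 * xi + nu))"
    and e1: "dr + m * r * sin (2 * p + nu) = sin p"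
    and e2: "r * (dp - r\<^sup>2 + L) + m * r * cos (2 * p + nu) = cos p"
    and e1': "dr' + m * (r + R) * sin (2 * (p + P) + nu) = sin (p + P)"
    and e2': "(r + R) * (dp' - (r + R)\<^sup>2 + L) + m * (r + R) * cos (2 * (p + P) + nu) = cos (p + P)"
  shows "R * P \<le> (dr' - dr) * P + R * (dp' - dp)"
proof -
  \<comment> \<open>The right-hand side of the radial equation with the radius in the
    \<open>m\<close> term frozen at \<open>r\<close>. Its derivative is the expression bounded below
    in \<open>slope\<close>, and the mean value theorem turns this into growth of
    \<open>R\<close>.\<close>
  define g where "g x = sin x - m * r * sin (2 * x + nu)" for x
  have "\<exists>z. p < z \<and> z < p + P \<and> g (p + P) - g p = (p + P - p) * (cos z - 2 * m * r * cos (2 * z + nu))"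
    unfolding g_def using P by (intro MVT2) (auto intro!: derivative_eq_intros)
  then obtain z where z: "p < z" "z < p + P"
      and gz: "g (p + P) - g p = P * (cos z - 2 * m * r * cos (2 * z + nu))"
    by auto
  have "1 / r \<le> cos z - 2 * m * r * cos (2 * z + nu)"
    using slope[of z] z r by (simp add: field_simps)
  then have g: "P * (1 / r) \<le> g (p + P) - g p"
    unfolding gz using P by (intro mult_left_mono) auto
  have "m * R * sin (2 * (p + P) + nu) \<le> \<bar>m\<bar> * R * 1"
  proof -
    have "m * R * sin (2 * (p + P) + nu) \<le> \<bar>m * R * sin (2 * (p + P) + nu)\<bar>"
      by simp
    also have "\<dots> = \<bar>m\<bar> * R * \<bar>sin (2 * (p + P) + nu)\<bar>"
      using R by (simp add: abs_mult)
    also have "\<dots> \<le> \<bar>m\<bar> * R * 1"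
      using R by (intro mult_left_mono) auto
    finally show ?thesis .
  qed
  moreover have "dr' - dr = g (p + P) - g p - m * R * sin (2 * (p + P) + nu)"
    using e1 e1' by (simp add: g_def algebra_simps)
  ultimately have lo1: "P / r - \<bar>m\<bar> * R \<le> dr' - dr"
    using g by simp
  have dp: "dp = r\<^sup>2 - L + cos p / r - m * cos (2 * p + nu)"
    using e2 r by (simp add: field_simps)
  have dp': "dp' = (r + R)\<^sup>2 - L + cos (p + P) / (r + R) - m * cos (2 * (p + P) + nu)"
    using e2' r R by (simp add: field_simps)
  \<comment> \<open>The difference of the two quotients is split into a change of the numerator over
    \<open>r + R\<close> and a change of the denominator under \<open>cos p\<close>.\<close>
  have "R / (r * (r + R)) = 1 / r - 1 / (r + R)"
    using r R by (simp add: diff_frac_eq)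
  then have "cos p / r - cos (p + P) / (r + R) = (cos p - cos (p + P)) / (r + R) + cos p * (R / (r * (r + R)))"
    by (simp add: right_diff_distrib diff_divide_distrib)
  also have "\<dots> \<le> P / r + R"
  proof (intro add_mono)
    show "(cos p - cos (p + P)) / (r + R) \<le> P / r"
      using cos_diff_le[of p "p + P"] r R P by (intro frac_le) auto
    have "1 * 1 \<le> r * (r + R)"
      using r R by (intro mult_mono) auto
    then have "R / (r * (r + R)) \<le> R / 1"
      using R by (intro divide_left_mono) auto
    then have "cos p * (R / (r * (r + R))) \<le> 1 * R"
      using r R by (intro mult_mono) auto
    then show "cos p * (R / (r * (r + R))) \<le> R"
      by simp
  qed
  finally have c: "cos p / r - cos (p + P) / (r + R) \<le> P / r + R" .
  have "m * (cos (2 * (p + P) + nu) - cos (2 * p + nu)) \<le> \<bar>m\<bar> * (2 * P)"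
  proof -
    have "m * (cos (2 * (p + P) + nu) - cos (2 * p + nu)) \<le> \<bar>m\<bar> * \<bar>cos (2 * (p + P) + nu) - cos (2 * p + nu)\<bar>"
      by (metis abs_ge_self abs_mult)
    also have "\<dots> \<le> \<bar>m\<bar> * (2 * P)"
      using cos_diff_le[of "2 * (p + P) + nu" "2 * p + nu"] P by (intro mult_left_mono) auto
    finally show ?thesis .
  qed
  moreover have "(r + R)\<^sup>2 - r\<^sup>2 = 2 * (r * R) + R\<^sup>2"
    by (simp add: power2_eq_square algebra_simps)
  \<comment> \<open>Of the gain \<open>2 * (r * R)\<close> one half is kept. The other half is at
    least \<open>2 * R\<close> and absorbs the error \<open>R\<close> from \<open>c\<close>.\<close>
  moreover have "2 * R \<le> r * R" "0 \<le> R\<^sup>2"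
    using r R by simp_all
  moreover have "(1 / r + 2 * \<bar>m\<bar>) * P = P / r + \<bar>m\<bar> * (2 * P)"
    by (simp add: algebra_simps)
  ultimately have lo2: "r * R - (1 / r + 2 * \<bar>m\<bar>) * P \<le> dp' - dp"
    using c R unfolding dp dp' right_diff_distrib by linarith
  \<comment> \<open>The weights 1/r and r are reciprocal, so the mean inequality leaves a cross term
    independent of \<open>r\<close>.\<close>
  have "0 \<le> (P - r * R)\<^sup>2 / r"
    using r by simp
  then have amgm: "2 * (R * P) \<le> P\<^sup>2 / r + r * R\<^sup>2"
    using r by (simp add: power2_eq_square field_simps)
  have "(3 * \<bar>m\<bar> + 1 / r) * (R * P) \<le> 1 * (R * P)"
    using small R P by (intro mult_right_mono) auto
  with amgm have "R * P \<le> (P / r - \<bar>m\<bar> * R) * P + R * (r * R - (1 / r + 2 * \<bar>m\<bar>) * P)"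
    by (simp add: algebra_simps power2_eq_square)
  also have "\<dots> \<le> (dr' - dr) * P + R * (dp' - dp)"
    using lo1 lo2 R P by (intro add_mono mult_left_mono mult_right_mono) auto
  finally show ?thesis .
qed

text \<open>
  Where \<open>rho = 0\<close>, the second equation of (MS) reduces to \<open>cos psi = 0\<close>, so from almost all
  initial values with \<open>rho 0 = 0\<close> no solution exists.
\<close>

lemma MS_stable_imp_nonzero:
  assumes "MS_stable lam nu mu rs ps"
  shows "rs 0 \<noteq> 0"
proof
  assume rs0: "rs 0 = 0"
  obtain eta where eta: "eta > 0"
    and sol: "\<And>r0 p0. \<bar>r0 - rs 0\<bar> + \<bar>p0 - ps 0\<bar> < eta \<Longrightarrow>
      \<exists>rho psi. solves_MS lam nu mu {0..} rho psi \<and> rho 0 = r0 \<and> psi 0 = p0"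
    using assms unfolding MS_stable_def by (meson zero_less_one)
  have zero: "cos p0 = 0" if p0: "\<bar>p0 - ps 0\<bar> < eta" for p0
  proof -
    obtain rho psi where "solves_MS lam nu mu {0..} rho psi" "rho 0 = 0" "psi 0 = p0"
      using sol[of 0 p0] p0 rs0 by auto
    then show ?thesis
      unfolding solves_MS_def by force
  qed
  \<comment> \<open>A second admissible initial angle less than \<open>pi\<close> away from
    \<open>ps 0\<close>; two zeros of the cosine cannot be that close.\<close>
  define s where "s = min (eta / 2) 1"
  have s: "0 < s" "s < pi" "s < eta"
    using eta pi_gt3 by (auto simp: s_def min_def)
  have "cos (ps 0) = 0" "cos (ps 0 + s) = 0"
    using zero s eta by auto
  then have "sin (ps 0) * sin s = 0"
    by (simp add: cos_add)
  moreover have "sin s \<noteq> 0"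
    using sin_gt_zero[OF s(1,2)] by simp
  ultimately show False
    using \<open>cos (ps 0) = 0\<close> by (metis mult_eq_0_iff sin_zero_abs_cos_one abs_zero zero_neq_one)
qed

section \<open>Instability from a one-sided slope bound\<close>

text \<open>All quantitative hypotheses concern times after \<open>T\<close>. The interval up to
  \<open>T\<close> is bridged by openness of the time-\<open>T\<close> map, which allows the
  perturbation to be placed in the quadrant at time \<open>T\<close> itself. From there the growth
  leads out of the tube.\<close>

lemma MS_unstable_criterion:
  assumes mu: "continuous_on {0..} mu"
    and star: "solves_MS lam nu mu {0..} rs ps"
    and e: "0 < e" "e \<le> 1" and T: "0 \<le> T"
    and large: "\<And>t. T \<le> t \<Longrightarrow> 2 \<le> rs t" and small: "\<And>t. T \<le> t \<Longrightarrow> 3 * \<bar>mu t\<bar> + 1 / rs t \<le> 1"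
    and slope: "\<And>t xi. \<lbrakk>T \<le> t; ps t \<le> xi; xi \<le> ps t + e\<rbrakk> \<Longrightarrow>
       1 \<le> rs t * (cos xi - 2 * mu t * rs t * cos (2 * xi + nu))"
  shows "\<not> MS_stable lam nu mu rs ps"
proof
  assume stable: "MS_stable lam nu mu rs ps"
  then obtain eta where eta: "eta > 0" and
    close: "\<And>r0 p0. \<bar>r0 - rs 0\<bar> + \<bar>p0 - ps 0\<bar> < eta \<Longrightarrow>
       (\<exists>rho psi. solves_MS lam nu mu {0..} rho psi \<and> rho 0 = r0 \<and> psi 0 = p0) \<and>
       (\<forall>S rho psi. (S = {0..} \<or> (\<exists>T>0. S = {0..<T})) \<longrightarrow>
          solves_MS lam nu mu S rho psi \<longrightarrow> rho 0 = r0 \<longrightarrow> psi 0 = p0 \<longrightarrow>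
          (\<forall>t\<in>S. \<bar>rho t - rs t\<bar> + \<bar>psi t - ps t\<bar> < e))"
    using e unfolding MS_stable_def by blast
  have "\<exists>rho psi. solves_MS lam nu mu {0..} rho psi \<and> rho 0 = r0 \<and> psi 0 = p0 \<and>
         (\<forall>t\<ge>0. \<bar>rho t - rs t\<bar> + \<bar>psi t - ps t\<bar> < e)"
    if ini: "\<bar>r0 - rs 0\<bar> + \<bar>p0 - ps 0\<bar> < eta" for r0 p0
  proof -
    obtain rho psi where s: "solves_MS lam nu mu {0..} rho psi" "rho 0 = r0" "psi 0 = p0"
      using close[OF ini] by blast
    moreover have "\<forall>t\<in>{0..}. \<bar>rho t - rs t\<bar> + \<bar>psi t - ps t\<bar> < e"
      using close[OF ini] s by blast
    ultimately show ?thesis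
      by auto
  qed
  from MS_reach_open[OF mu star MS_stable_imp_nonzero[OF stable] T eta this]
  obtain d where d: "d > 0" and
    reach: "\<And>w. w \<in> ball (rcis (rs T) (ps T)) d \<Longrightarrow>
       \<exists>rho psi. solves_MS lam nu mu {0..} rho psi \<and> rcis (rho T) (psi T) = w \<and>
         (\<forall>t\<ge>0. \<bar>rho t - rs t\<bar> + \<bar>psi t - ps t\<bar> < e)"
    by metis
  \<comment> \<open>The target is shifted along the diagonal of the quadrant, by an amount
    \<open>h\<close> that keeps it within the reachable ball.\<close>
  have "((\<lambda>h. rcis (rs T + h) (ps T + h)) \<longlongrightarrow> rcis (rs T + 0) (ps T + 0)) (at_right 0)"
    by (intro tendsto_intros)
  then have "\<forall>\<^sub>F h in at_right 0. rcis (rs T + h) (ps T + h) \<in> ball (rcis (rs T) (ps T)) d"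
    using d by (auto simp: tendsto_iff dist_commute)
  then obtain b where b: "b > 0" "\<And>h. 0 < h \<Longrightarrow> h < b \<Longrightarrow>
      rcis (rs T + h) (ps T + h) \<in> ball (rcis (rs T) (ps T)) d"
    by (auto simp: eventually_at_right_field)
  define h where "h = min (b / 2) 1"
  have h: "0 < h" "h < b" "h \<le> 1"
    using b by (auto simp: h_def min_def)
  obtain rho psi where sol: "solves_MS lam nu mu {0..} rho psi"
      and hit: "rcis (rho T) (psi T) = rcis (rs T + h) (ps T + h)"
      and near: "\<And>t. 0 \<le> t \<Longrightarrow> \<bar>rho t - rs t\<bar> + \<bar>psi t - ps t\<bar> < e"
    using reach[OF b(2)[OF h(1,2)]] by blast
  \<comment> \<open>These side conditions recover the polar coordinates of the target:
    \<open>rs T\<close> is at least 2 and the tube has width at most 1, so \<open>rho T\<close> is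
    positive.\<close>
  have "0 < rho T * (rs T + h)" "\<bar>psi T - (ps T + h)\<bar> < 2 * pi"
    using near[OF T] large[of T] h e pi_gt3 by (auto intro!: mult_pos_pos)
  from rcis_eq_near_imp_eq[OF hit this]
  have init: "0 < rho T - rs T" "0 < psi T - ps T"
    using h by auto
  obtain ds dq where star': "\<And>t. 0 \<le> t \<Longrightarrow> (rs has_real_derivative ds t) (at t within {0..})"
      "\<And>t. 0 \<le> t \<Longrightarrow> (ps has_real_derivative dq t) (at t within {0..})"
      "\<And>t. 0 \<le> t \<Longrightarrow> ds t + mu t * rs t * sin (2 * ps t + nu) = sin (ps t)"
      "\<And>t. 0 \<le> t \<Longrightarrow> rs t * (dq t - (rs t)\<^sup>2 + lam * t) + mu t * rs t * cos (2 * ps t + nu) = cos (ps t)"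
    using star unfolding solves_MS_def by auto
  obtain dr dp where sol': "\<And>t. 0 \<le> t \<Longrightarrow> (rho has_real_derivative dr t) (at t within {0..})"
      "\<And>t. 0 \<le> t \<Longrightarrow> (psi has_real_derivative dp t) (at t within {0..})"
      "\<And>t. 0 \<le> t \<Longrightarrow> dr t + mu t * rho t * sin (2 * psi t + nu) = sin (psi t)"
      "\<And>t. 0 \<le> t \<Longrightarrow> rho t * (dp t - (rho t)\<^sup>2 + lam * t) + mu t * rho t * cos (2 * psi t + nu) = cos (psi t)"
    using sol unfolding solves_MS_def by auto
  \<comment> \<open>The threshold 1 cannot be exceeded inside the tube, where both differences are
    smaller than \<open>e\<close>, which is at most 1.\<close>
  have "\<exists>t\<ge>T. 1 < (rho t - rs t) * (psi t - ps t)"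
  proof (rule quadrant_escape[where R' = "\<lambda>t. dr t - ds t" and P' = "\<lambda>t. dp t - dq t"])
    fix t assume t: "T \<le> t"
    then have t0: "0 \<le> t" and sub: "{T..} \<subseteq> {0..}"
      using T by auto
    show "((\<lambda>t. rho t - rs t) has_real_derivative dr t - ds t) (at t within {T..})"
      "((\<lambda>t. psi t - ps t) has_real_derivative dp t - dq t) (at t within {T..})"
      by (intro DERIV_diff DERIV_subset[OF _ sub] sol' star' t0)+
    assume pos: "0 < rho t - rs t" "0 < psi t - ps t"
    show "(rho t - rs t) * (psi t - ps t) \<le> (dr t - ds t) * (psi t - ps t) + (rho t - rs t) * (dp t - dq t)"
    proof (rule MS_quadrant_growth[OF large[OF t] small[OF t] pos _ star'(3,4)[OF t0]])
      fix xi assume "ps t \<le> xi" "xi \<le> ps t + (psi t - ps t)"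
      then show "1 \<le> rs t * (cos xi - 2 * mu t * rs t * cos (2 * xi + nu))"
        using near[OF t0] pos by (intro slope[OF t]) auto
    qed (use sol'(3,4)[OF t0] in simp_all)
  qed (rule init)+
  then obtain t where t: "T \<le> t" "1 < (rho t - rs t) * (psi t - ps t)"
    by blast
  have "\<bar>rho t - rs t\<bar> * \<bar>psi t - ps t\<bar> \<le> 1 * 1"
    using near[of t] t T e by (intro mult_mono) auto
  then have "\<bar>(rho t - rs t) * (psi t - ps t)\<bar> \<le> 1"
    by (simp add: abs_mult)
  with t show False
    by linarith
qed

section \<open>Consequences of the asymptotic expansions\<close>

lemma PP1_has_derivative:
    "((\<lambda>x. PP1 x d n) has_real_derivative PP2 x d n) (at x)"
  and PP2_has_derivative:
    "((\<lambda>x. PP2 x d n) has_real_derivative PP3 x d n) (at x)"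
  unfolding PP1_def PP2_def PP3_def by (auto intro!: derivative_eq_intros)

text \<open>The truncation at N = 0 has an empty sum and bounds the difference by t^(-1/m).\<close>

lemma asymp_series_tendsto:
  assumes "asymp_series f g m a" "m > 0"
  shows "((\<lambda>t. f t - g t) \<longlongrightarrow> 0) at_top"
proof -
  have "(\<lambda>t. f t - g t) \<in> O(\<lambda>t. t powr (- 1 / real m))"
    using assms(1)[unfolded asymp_series_def, rule_format, of 0] by simp
  also have "(\<lambda>t::real. t powr (- 1 / real m)) \<in> o(\<lambda>t. t powr 0)"
    using assms(2) by (subst powr_smallo_iff) (auto simp: filterlim_ident)
  also have "(\<lambda>t::real. t powr 0) \<in> O(\<lambda>_. 1)"
    by real_asymp
  finally show ?thesis
    by (auto dest: smalloD_tendsto)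
qed

text \<open>In the truncation at N = 1 half of the leading term absorbs the remainder. In the
  degenerate cases this keeps \<open>ps\<close> to the right of the root at a known
  distance.\<close>

lemma asymp_series_lower_bound:
  assumes "asymp_series f (\<lambda>_. s) m a" "m > 0" "a 1 > 0"
  shows "\<forall>\<^sub>F t in at_top. a 1 / 2 * t powr (- 1 / real m) \<le> f t - s"
proof -
  have "(\<lambda>t. f t - s - a 1 * t powr (- 1 / real m)) \<in> O(\<lambda>t. t powr (- 2 / real m))"
    using assms(1)[unfolded asymp_series_def, rule_format, of 1] by simp
  also have "(\<lambda>t::real. t powr (- 2 / real m)) \<in> o(\<lambda>t. t powr (- 1 / real m))"
    using assms(2) by (subst powr_smallo_iff) (auto simp: filterlim_ident divide_strict_right_mono)
  finally have "\<forall>\<^sub>F t in at_top. norm (f t - s - a 1 * t powr (- 1 / real m))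
      \<le> a 1 / 2 * norm (t powr (- 1 / real m))"
    using assms(3) by (intro landau_o.smallD) auto
  then show ?thesis
  proof eventually_elim
    case (elim t)
    then show ?case
      unfolding real_norm_def abs_of_nonneg[OF powr_ge_zero] by linarith
  qed
qed

text \<open>With E and G the errors of the leading terms of \<open>mu\<close> and \<open>rs\<close>,
  mu rs - delta equals E rs + mu_0 t^(-1/2) G, since the leading powers cancel. The hypothesis on
  \<open>rs\<close> is what all three expansion types have in common.\<close>

lemma mu_rho_expansion:
  assumes mu: "mu_expansion mu mc"
    and rs: "((\<lambda>t. rs t - sqrt lam * t powr (1/2)) \<longlongrightarrow> 0) at_top"
  shows "(\<lambda>t. mu t * rs t - mc 0 * sqrt lam) \<in> O(\<lambda>t. t powr (- 1 / 2))"
proof -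
  define E where "E t = mu t - mc 0 * t powr (- 1 / 2)" for t
  define G where "G t = rs t - sqrt lam * t powr (1/2)" for t
  have "(\<lambda>t. mu t - t powr (- 1 / 2) * (mc 0 * t powr 0)) \<in> O(\<lambda>t. t powr (- 3 / 2))"
    using mu[unfolded mu_expansion_def, rule_format, of 0] by simp
  \<comment> \<open>Restricted to positive t because \<open>t powr 0\<close> is 1 there but 0 at t =
    0.\<close>
  also have "?this \<longleftrightarrow> E \<in> O(\<lambda>t. t powr (- 3 / 2))"
    unfolding E_def
    by (intro landau_o.big.in_cong eventually_mono[OF eventually_gt_at_top[of 0]]) auto
  finally have E: "E \<in> O(\<lambda>t. t powr (- 3 / 2))" .
  have "G \<in> o(\<lambda>_. 1)"
    using rs unfolding G_def by (intro smalloI_tendsto) auto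
  then have G: "G \<in> O(\<lambda>_. 1)"
    by (rule landau_o.small_imp_big)
  have "(\<lambda>t::real. 1 :: real) \<in> O(\<lambda>t. t powr (1/2))" "(\<lambda>t. sqrt lam * t powr (1/2)) \<in> O(\<lambda>t. t powr (1/2))"
    by real_asymp simp
  then have R: "(\<lambda>t. G t + sqrt lam * t powr (1/2)) \<in> O(\<lambda>t. t powr (1/2))"
    using landau_o.big_trans[OF G] by (intro sum_in_bigo) auto
  have "(\<lambda>t. E t * (G t + sqrt lam * t powr (1/2))) \<in> O(\<lambda>t. t powr (- 3 / 2) * t powr (1/2))"
    by (intro landau_o.big.mult E R)
  also have "(\<lambda>t::real. t powr (- 3 / 2) * t powr (1/2)) \<in> O(\<lambda>t. t powr (- 1 / 2))"
    by real_asymp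
  finally have 1: "(\<lambda>t. E t * (G t + sqrt lam * t powr (1/2))) \<in> O(\<lambda>t. t powr (- 1 / 2))" .
  have "(\<lambda>t. (mc 0 * t powr (- 1 / 2)) * G t) \<in> O(\<lambda>t. t powr (- 1 / 2) * 1)"
    by (intro landau_o.big.mult G) simp
  then have "(\<lambda>t. E t * (G t + sqrt lam * t powr (1/2)) + mc 0 * t powr (- 1 / 2) * G t) \<in> O(\<lambda>t. t powr (- 1 / 2))"
    using 1 by (intro sum_in_bigo) auto
  also have "?this \<longleftrightarrow> ?thesis"
  proof (intro landau_o.big.in_cong eventually_mono[OF eventually_gt_at_top[of 0]])
    fix t :: real assume "0 < t"
    then have "t powr (- 1 / 2) * t powr (1 / 2) = 1"
      by (simp flip: powr_add)
    then have "mc 0 * t powr (- 1 / 2) * (sqrt lam * t powr (1/2)) = mc 0 * sqrt lam"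
      by (metis mult.assoc mult.commute mult.right_neutral)
    then show "E t * (G t + sqrt lam * t powr (1/2)) + mc 0 * t powr (- 1 / 2) * G t
        = mu t * rs t - mc 0 * sqrt lam"
      by (simp add: E_def G_def algebra_simps)
  qed
  finally show ?thesis .
qed

lemma mu_expansion_tendsto:
  assumes "mu_expansion mu mc"
  shows "(mu \<longlongrightarrow> 0) at_top"
proof -
  have "(\<lambda>t. mu t - t powr (- 1 / 2) * (mc 0 * t powr 0)) \<in> O(\<lambda>t. t powr (- 3 / 2))"
    using assms[unfolded mu_expansion_def, rule_format, of 0] by simp
  also have "(\<lambda>t::real. t powr (- 3 / 2)) \<in> o(\<lambda>_. 1)"
    by real_asymp
  finally have "((\<lambda>t. mu t - t powr (- 1 / 2) * (mc 0 * t powr 0)) \<longlongrightarrow> 0) at_top"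
    by (auto dest: smalloD_tendsto)
  moreover have "((\<lambda>t::real. t powr (- 1 / 2) * (mc 0 * t powr 0)) \<longlongrightarrow> 0) at_top"
    by real_asymp
  ultimately show ?thesis
    using tendsto_add by fastforce
qed

text \<open>The rate t^(-1/3) is the weakest that the three cases produce. It still dominates the
  O(t^(-1/2)) error of replacing mu rs by delta, and multiplied by \<open>rs\<close>, of order
  t^(1/2), it tends to infinity.\<close>

lemma MS_unstable_if_slope:
  assumes lam: "lam > 0" and mu_smooth: "smooth_on_nonneg mu" and mu_exp: "mu_expansion mu mc"
    and star: "solves_MS lam nu mu {0..} rs ps"
    and rs: "((\<lambda>t. rs t - sqrt lam * t powr (1/2)) \<longlongrightarrow> 0) at_top"
    and a: "0 < a" and e: "0 < e"
    and slope: "\<forall>\<^sub>F t in at_top. \<forall>xi. ps t \<le> xi \<and> xi \<le> ps t + e \<longrightarrow>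
       PP1 xi (mc 0 * sqrt lam) nu \<le> - a * t powr (- 1 / 3)"
  shows "\<not> MS_stable lam nu mu rs ps"
proof -
  have cont: "continuous_on {0..} mu"
    using mu_smooth unfolding smooth_on_nonneg_def
    by (metis DERIV_continuous atLeast_iff continuous_on_eq_continuous_within)
  have "(\<lambda>t. mu t * rs t - mc 0 * sqrt lam) \<in> O(\<lambda>t. t powr (- 1 / 2))"
    by (rule mu_rho_expansion[OF mu_exp rs])
  also have "(\<lambda>t::real. t powr (- 1 / 2)) \<in> o(\<lambda>t. t powr (- 1 / 3))"
    by real_asymp
  finally have "\<forall>\<^sub>F t in at_top. norm (mu t * rs t - mc 0 * sqrt lam) \<le> a / 4 * norm (t powr (- 1 / 3))"
    using a by (intro landau_o.smallD) auto
  \<comment> \<open>The error enters the slope with a factor 2, so a quarter of \<open>a\<close>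
    costs one half of the available bound.\<close>
  then have ev1: "\<forall>\<^sub>F t in at_top. \<bar>mu t * rs t - mc 0 * sqrt lam\<bar> \<le> a / 4 * t powr (- 1 / 3)"
    by simp
  have ev2: "\<forall>\<^sub>F t in at_top. \<bar>rs t - sqrt lam * t powr (1/2)\<bar> < 1"
    using tendstoD[OF rs, of 1] by simp
  have ev3: "\<forall>\<^sub>F t in at_top. \<bar>mu t\<bar> < 1 / 6"
    using tendstoD[OF mu_expansion_tendsto[OF mu_exp], of "1 / 6"] by simp
  have s: "0 < sqrt lam"
    using lam by simp
  have ev4: "\<forall>\<^sub>F t in at_top. 3 \<le> sqrt lam * t powr (1/2)"
    using s by real_asymp
  have ev5: "\<forall>\<^sub>F t in at_top. 1 \<le> (sqrt lam * t powr (1/2) - 1) * (a / 2 * t powr (- 1 / 3))"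
    using s a by real_asymp
  have "\<forall>\<^sub>F t in at_top. 2 \<le> rs t \<and> 3 * \<bar>mu t\<bar> + 1 / rs t \<le> 1 \<and>
     (\<forall>xi. ps t \<le> xi \<and> xi \<le> ps t + e \<longrightarrow> 1 \<le> rs t * (cos xi - 2 * mu t * rs t * cos (2 * xi + nu)))"
    using slope ev1 ev2 ev3 ev4 ev5
  proof eventually_elim
    case (elim t)
    have r: "2 \<le> rs t" "sqrt lam * t powr (1/2) - 1 \<le> rs t"
      using elim(3,5) by linarith+
    then have "1 / rs t \<le> 1 / 2"
      by (intro divide_left_mono) auto
    then have m: "3 * \<bar>mu t\<bar> + 1 / rs t \<le> 1"
      using elim(4) by linarith
    have "1 \<le> rs t * (cos xi - 2 * mu t * rs t * cos (2 * xi + nu))"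
      if xi: "ps t \<le> xi" "xi \<le> ps t + e" for xi
    proof -
      have "\<bar>(mu t * rs t - mc 0 * sqrt lam) * cos (2 * xi + nu)\<bar> \<le> a / 4 * t powr (- 1 / 3) * 1"
        unfolding abs_mult using elim(2) a by (intro mult_mono) auto
      moreover have "PP1 xi (mc 0 * sqrt lam) nu \<le> - a * t powr (- 1 / 3)"
        using elim(1) xi by blast
      moreover have "cos xi - 2 * mu t * rs t * cos (2 * xi + nu)
          = - PP1 xi (mc 0 * sqrt lam) nu - 2 * ((mu t * rs t - mc 0 * sqrt lam) * cos (2 * xi + nu))"
        by (simp add: PP1_def algebra_simps)
      ultimately have "a / 2 * t powr (- 1 / 3) \<le> cos xi - 2 * mu t * rs t * cos (2 * xi + nu)"
        by linarith
      then have "(sqrt lam * t powr (1/2) - 1) * (a / 2 * t powr (- 1 / 3))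
          \<le> rs t * (cos xi - 2 * mu t * rs t * cos (2 * xi + nu))"
        using r a by (intro mult_mono) auto
      with elim(6) show ?thesis
        by linarith
    qed
    with r m show ?case
      by blast
  qed
  then obtain T where T: "\<And>t. T \<le> t \<Longrightarrow> 2 \<le> rs t \<and> 3 * \<bar>mu t\<bar> + 1 / rs t \<le> 1 \<and>
     (\<forall>xi. ps t \<le> xi \<and> xi \<le> ps t + e \<longrightarrow> 1 \<le> rs t * (cos xi - 2 * mu t * rs t * cos (2 * xi + nu)))"
    by (auto simp: eventually_at_top_linorder)
  show ?thesis
    by (rule MS_unstable_criterion[OF cont star, of "min e 1" "max T 0"]) (use e T in auto)
qed

section \<open>Sign of the derivative of P near the root\<close>

lemma negative_near:
  fixes f :: "real \<Rightarrow> real"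
  assumes "isCont f s" "f s < 0"
  obtains d where "d > 0" "\<And>x. \<bar>x - s\<bar> < d \<Longrightarrow> f x \<le> f s / 2"
proof -
  have "\<forall>\<^sub>F x in nhds s. f x < f s / 2"
    using assms by (intro order_tendstoD(2)[of f "f s"]) (auto simp: isCont_def tendsto_at_iff_tendsto_nhds)
  then show thesis
    unfolding eventually_nhds_metric dist_real_def by (meson that less_imp_le)
qed

text \<open>Near s the derivative stays below half its value at s; integrating from s to the right
  gives the linear bound.\<close>

lemma negative_derivative_near:
  fixes f f' :: "real \<Rightarrow> real"
  assumes "\<And>x. (f has_real_derivative f' x) (at x)" "isCont f' s" "f s = 0" "f' s < 0"
  obtains d where "d > 0" "\<And>x. s \<le> x \<Longrightarrow> x < s + d \<Longrightarrow> f x \<le> f' s / 2 * (x - s)"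
proof -
  obtain d where d: "d > 0" "\<And>x. \<bar>x - s\<bar> < d \<Longrightarrow> f' x \<le> f' s / 2"
    using negative_near[OF assms(2,4)] by blast
  have "f x \<le> f' s / 2 * (x - s)" if x: "s \<le> x" "x < s + d" for x
  proof -
    have "f x - f' s / 2 * (x - s) \<le> f s - f' s / 2 * (s - s)"
    proof (rule DERIV_nonpos_imp_nonincreasing[OF x(1)])
      fix y assume "s \<le> y" "y \<le> x"
      then have "f' y - f' s / 2 \<le> 0"
        using d(2)[of y] x by auto
      moreover have "((\<lambda>x. f x - f' s / 2 * (x - s)) has_real_derivative f' y - f' s / 2) (at y)"
        by (auto intro!: derivative_eq_intros assms(1))
      ultimately show "\<exists>D. ((\<lambda>x. f x - f' s / 2 * (x - s)) has_real_derivative D) (at y) \<and> D \<le> 0"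
        by blast
    qed
    then show ?thesis
      using assms(3) by simp
  qed
  with d(1) show thesis
    by (rule that)
qed

text \<open>The linear bound for \<open>f'\<close> is integrated once more, which turns the factor
  1/2 into 1/4.\<close>

lemma negative_second_derivative_near:
  fixes f f' f'' :: "real \<Rightarrow> real"
  assumes "\<And>x. (f has_real_derivative f' x) (at x)" "\<And>x. (f' has_real_derivative f'' x) (at x)"
    "isCont f'' s" "f s = 0" "f' s = 0" "f'' s < 0"
  obtains d where "d > 0" "\<And>x. s \<le> x \<Longrightarrow> x < s + d \<Longrightarrow> f x \<le> f'' s / 4 * (x - s)\<^sup>2"
proof -
  obtain d where d: "d > 0" "\<And>x. s \<le> x \<Longrightarrow> x < s + d \<Longrightarrow> f' x \<le> f'' s / 2 * (x - s)"
    using negative_derivative_near[OF assms(2,3,5,6)] by blast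
  have "f x \<le> f'' s / 4 * (x - s)\<^sup>2" if x: "s \<le> x" "x < s + d" for x
  proof -
    have "f x - f'' s / 4 * (x - s)\<^sup>2 \<le> f s - f'' s / 4 * (s - s)\<^sup>2"
    proof (rule DERIV_nonpos_imp_nonincreasing[OF x(1)])
      fix y assume "s \<le> y" "y \<le> x"
      then have "f' y - f'' s / 2 * (y - s) \<le> 0"
        using d(2)[of y] x by auto
      moreover have "((\<lambda>x. f x - f'' s / 4 * (x - s)\<^sup>2) has_real_derivative f' y - f'' s / 2 * (y - s)) (at y)"
        by (auto intro!: derivative_eq_intros assms(1))
      ultimately show "\<exists>D. ((\<lambda>x. f x - f'' s / 4 * (x - s)\<^sup>2) has_real_derivative D) (at y) \<and> D \<le> 0"
        by blast
    qed
    then show ?thesis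
      using assms(4) by simp
  qed
  with d(1) show thesis
    by (rule that)
qed

section \<open>The three cases\<close>

theorem theorem3:
  fixes lam nu sigma :: real and mu :: "real \<Rightarrow> real" and mc :: "nat \<Rightarrow> real"
  assumes lam: "lam > 0"
    and nu: "0 \<le> nu" "nu < pi"
    and mu_smooth: "smooth_on_nonneg mu"
    and mu_exp: "mu_expansion mu mc"
    and root: "PP sigma (mc 0 * sqrt lam) nu = 0"
  shows
    "(PP1 sigma (mc 0 * sqrt lam) nu < 0 \<longrightarrow>
       (\<forall>rs ps rk pk. solves_MS lam nu mu {0..} rs ps \<and>
          asymp_series rs (\<lambda>t. sqrt lam * t powr (1/2)) 2 rk \<and>
          asymp_series ps (\<lambda>t. sigma) 2 pk
          \<longrightarrow> \<not> MS_stable lam nu mu rs ps))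
   \<and> (PP1 sigma (mc 0 * sqrt lam) nu = 0 \<and> PP2 sigma (mc 0 * sqrt lam) nu < 0 \<longrightarrow>
       (\<forall>rs ps rk pk. solves_MS lam nu mu {0..} rs ps \<and>
          asymp_series rs (\<lambda>t. sqrt lam * t powr (1/2)) 4 rk \<and> rk 1 = 0 \<and>
          asymp_series ps (\<lambda>t. sigma) 4 pk \<and>
          pk 1 = sqrt (- sqrt lam / PP2 sigma (mc 0 * sqrt lam) nu)
          \<longrightarrow> \<not> MS_stable lam nu mu rs ps))
   \<and> (PP1 sigma (mc 0 * sqrt lam) nu = 0 \<and> PP2 sigma (mc 0 * sqrt lam) nu = 0 \<and>
       PP3 sigma (mc 0 * sqrt lam) nu < 0 \<longrightarrow>
       (\<forall>rs ps rk pk. solves_MS lam nu mu {0..} rs ps \<and>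
          asymp_series rs (\<lambda>t. sqrt lam * t powr (1/2)) 6 rk \<and> rk 1 = 0 \<and>
          asymp_series ps (\<lambda>t. sigma) 6 pk \<and>
          pk 1 = - root 3 (3 * sqrt lam / PP3 sigma (mc 0 * sqrt lam) nu)
          \<longrightarrow> \<not> MS_stable lam nu mu rs ps))"
proof -
  define d where "d = mc 0 * sqrt lam"
  have sl: "0 < sqrt lam"
    using lam by simp
  have powr_le: "\<forall>\<^sub>F t::real in at_top. t powr (- 1 / 3) \<le> t powr p" if "- 1 / 3 \<le> p" for p
    using eventually_ge_at_top[of 1] by eventually_elim (use that in \<open>auto intro: powr_mono\<close>)
  have near: "\<forall>\<^sub>F t in at_top. \<bar>ps t - sigma\<bar> < e" if "asymp_series ps (\<lambda>t. sigma) m pk" "m > 0" "e > 0" for ps m pk e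
    using tendstoD[OF asymp_series_tendsto[OF that(1,2)] that(3)] by simp
  \<comment> \<open>At a simple root the slope is bounded away from 0 near sigma, which is stronger
    than the required rate. Here and below, \<open>ps t\<close> stays within \<open>e / 2\<close> of
    sigma and \<open>xi\<close> exceeds it by at most \<open>e / 4\<close>, so \<open>xi\<close>
    stays within \<open>e\<close>.\<close>
  have I: "\<not> MS_stable lam nu mu rs ps"
    if P: "PP1 sigma d nu < 0" and star: "solves_MS lam nu mu {0..} rs ps"
      and rs: "asymp_series rs (\<lambda>t. sqrt lam * t powr (1/2)) 2 rk"
      and ps: "asymp_series ps (\<lambda>t. sigma) 2 pk" for rs ps rk pk
  proof -
    obtain e where e: "e > 0" "\<And>x. \<bar>x - sigma\<bar> < e \<Longrightarrow> PP1 x d nu \<le> PP1 sigma d nu / 2"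
      using negative_near[OF DERIV_isCont[OF PP1_has_derivative] P] by blast
    have "\<forall>\<^sub>F t in at_top. \<bar>ps t - sigma\<bar> < e / 2"
      by (rule near[OF ps]) (use e(1) in auto)
    moreover have "\<forall>\<^sub>F t::real in at_top. t powr (- 1 / 3) \<le> t powr 0"
      by (rule powr_le) simp
    ultimately have "\<forall>\<^sub>F t in at_top. \<forall>xi. ps t \<le> xi \<and> xi \<le> ps t + e / 4 \<longrightarrow>
       PP1 xi d nu \<le> - (- PP1 sigma d nu / 2) * t powr (- 1 / 3)"
      using eventually_gt_at_top[of 0]
    proof eventually_elim
      case (elim t)
      have "PP1 sigma d nu / 2 * 1 \<le> PP1 sigma d nu / 2 * t powr (- 1 / 3)"
        using elim(2,3) P by (intro mult_left_mono_neg) auto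
      moreover have "PP1 xi d nu \<le> PP1 sigma d nu / 2" if "ps t \<le> xi \<and> xi \<le> ps t + e / 4" for xi
        using elim(1) that by (intro e(2)) arith
      ultimately show ?case
        by fastforce
    qed
    then show ?thesis
      unfolding d_def using P e(1)
      by (intro MS_unstable_if_slope[OF lam mu_smooth mu_exp star asymp_series_tendsto[OF rs],
            of "- PP1 sigma d nu / 2" "e / 4"])
        (auto simp: d_def)
  qed
  \<comment> \<open>\<open>PP1\<close> changes sign at sigma from positive to negative. The choice
    of the positive root for \<open>pk 1\<close> puts \<open>ps\<close> on the negative side, at a
    distance of order t^(-1/4), and \<open>PP1\<close> is at most a negative multiple of this
    distance.\<close>
  have II: "\<not> MS_stable lam nu mu rs ps"
    if P: "PP1 sigma d nu = 0" "PP2 sigma d nu < 0" and star: "solves_MS lam nu mu {0..} rs ps"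
      and rs: "asymp_series rs (\<lambda>t. sqrt lam * t powr (1/2)) 4 rk"
      and ps: "asymp_series ps (\<lambda>t. sigma) 4 pk"
      and pk: "pk 1 = sqrt (- sqrt lam / PP2 sigma d nu)" for rs ps rk pk
  proof -
    have pk0: "pk 1 > 0"
      unfolding pk using divide_pos_neg[OF sl P(2)] by simp
    obtain e where e: "e > 0"
      "\<And>x. sigma \<le> x \<Longrightarrow> x < sigma + e \<Longrightarrow> PP1 x d nu \<le> PP2 sigma d nu / 2 * (x - sigma)"
      using negative_derivative_near[OF PP1_has_derivative DERIV_isCont[OF PP2_has_derivative] P] by blast
    have "\<forall>\<^sub>F t in at_top. \<bar>ps t - sigma\<bar> < e / 2"
      by (rule near[OF ps]) (use e(1) in auto)
    moreover have "\<forall>\<^sub>F t::real in at_top. t powr (- 1 / 3) \<le> t powr (- 1 / 4)"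
      by (rule powr_le) simp
    moreover have "\<forall>\<^sub>F t in at_top. pk 1 / 2 * t powr (- 1 / 4) \<le> ps t - sigma"
      using asymp_series_lower_bound[OF ps _ pk0] by simp
    ultimately have "\<forall>\<^sub>F t in at_top. \<forall>xi. ps t \<le> xi \<and> xi \<le> ps t + e / 4 \<longrightarrow>
       PP1 xi d nu \<le> - (- PP2 sigma d nu / 2 * (pk 1 / 2)) * t powr (- 1 / 3)"
    proof eventually_elim
      case (elim t)
      have lo: "pk 1 / 2 * t powr (- 1 / 3) \<le> ps t - sigma"
        using elim(2,3) pk0 by (meson order_trans mult_left_mono half_gt_zero less_imp_le)
      then have "0 \<le> ps t - sigma"
        using pk0 by (meson order_trans mult_nonneg_nonneg half_gt_zero less_imp_le powr_ge_zero)
      have "PP1 xi d nu \<le> PP2 sigma d nu / 2 * (pk 1 / 2 * t powr (- 1 / 3))"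
        if xi: "ps t \<le> xi \<and> xi \<le> ps t + e / 4" for xi
      proof -
        have "PP1 xi d nu \<le> PP2 sigma d nu / 2 * (xi - sigma)"
          using elim(1) xi \<open>0 \<le> ps t - sigma\<close> by (intro e(2)) arith+
        also have "\<dots> \<le> PP2 sigma d nu / 2 * (pk 1 / 2 * t powr (- 1 / 3))"
          using lo xi P(2) by (intro mult_left_mono_neg) auto
        finally show ?thesis .
      qed
      then show ?case
        by (simp add: mult.assoc)
    qed
    then show ?thesis
      using P(2) pk0 e(1)
      by (intro MS_unstable_if_slope[OF lam mu_smooth mu_exp star asymp_series_tendsto[OF rs],
            of "- PP2 sigma d nu / 2 * (pk 1 / 2)" "e / 4"])
        (auto simp: d_def intro: mult_neg_pos)
  qed
  \<comment> \<open>Since \<open>PP3\<close> is negative at sigma, \<open>pk 1\<close> is positive.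
    Now \<open>PP1\<close> vanishes to second order, so the distance of order t^(-1/6) enters
    squared and yields exactly the rate t^(-1/3).\<close>
  have III: "\<not> MS_stable lam nu mu rs ps"
    if P: "PP1 sigma d nu = 0" "PP2 sigma d nu = 0" "PP3 sigma d nu < 0"
      and star: "solves_MS lam nu mu {0..} rs ps"
      and rs: "asymp_series rs (\<lambda>t. sqrt lam * t powr (1/2)) 6 rk"
      and ps: "asymp_series ps (\<lambda>t. sigma) 6 pk"
      and pk: "pk 1 = - root 3 (3 * sqrt lam / PP3 sigma d nu)" for rs ps rk pk
  proof -
    have pk0: "pk 1 > 0"
      unfolding pk using divide_pos_neg[OF sl P(3)] by (simp add: real_root_lt_0_iff)
    have cont: "isCont (\<lambda>x. PP3 x d nu) sigma"
      unfolding PP3_def by (intro continuous_intros)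
    obtain e where e: "e > 0"
      "\<And>x. sigma \<le> x \<Longrightarrow> x < sigma + e \<Longrightarrow> PP1 x d nu \<le> PP3 sigma d nu / 4 * (x - sigma)\<^sup>2"
      using negative_second_derivative_near[OF PP1_has_derivative PP2_has_derivative cont P] by blast
    have "\<forall>\<^sub>F t in at_top. \<bar>ps t - sigma\<bar> < e / 2"
      by (rule near[OF ps]) (use e(1) in auto)
    moreover have "\<forall>\<^sub>F t in at_top. pk 1 / 2 * t powr (- 1 / 6) \<le> ps t - sigma"
      using asymp_series_lower_bound[OF ps _ pk0] by simp
    ultimately have "\<forall>\<^sub>F t in at_top. \<forall>xi. ps t \<le> xi \<and> xi \<le> ps t + e / 4 \<longrightarrow>
       PP1 xi d nu \<le> - (- PP3 sigma d nu / 4 * (pk 1 / 2)\<^sup>2) * t powr (- 1 / 3)"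
      using eventually_gt_at_top[of 0]
    proof eventually_elim
      case (elim t)
      have "0 \<le> pk 1 / 2 * t powr (- 1 / 6)"
        using pk0 by simp
      have sq: "(t powr (- 1 / 6))\<^sup>2 = t powr (- 1 / 3)"
        by (simp add: power2_eq_square flip: powr_add)
      have "PP1 xi d nu \<le> PP3 sigma d nu / 4 * ((pk 1 / 2)\<^sup>2 * t powr (- 1 / 3))"
        if xi: "ps t \<le> xi \<and> xi \<le> ps t + e / 4" for xi
      proof -
        have "PP1 xi d nu \<le> PP3 sigma d nu / 4 * (xi - sigma)\<^sup>2"
          using elim(1,2) xi \<open>0 \<le> pk 1 / 2 * t powr (- 1 / 6)\<close> by (intro e(2)) arith+
        also have "\<dots> \<le> PP3 sigma d nu / 4 * (pk 1 / 2 * t powr (- 1 / 6))\<^sup>2"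
          using elim(2) xi P(3) \<open>0 \<le> pk 1 / 2 * t powr (- 1 / 6)\<close>
          by (intro mult_left_mono_neg power_mono) auto
        finally show ?thesis
          by (simp only: power_mult_distrib sq)
      qed
      then show ?case
        by (simp add: mult.assoc)
    qed
    then show ?thesis
      using P(3) pk0 e(1)
      by (intro MS_unstable_if_slope[OF lam mu_smooth mu_exp star asymp_series_tendsto[OF rs],
            of "- PP3 sigma d nu / 4 * (pk 1 / 2)\<^sup>2" "e / 4"])
        (auto simp: d_def intro: mult_neg_pos)
  qed
  show ?thesis
    using I II III unfolding d_def by blast
qed

end
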